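(* Let $R$ be an integral domain with quotient field $K$ and let $I$ be an ideal of $R$. Consider the following statements: (a) $I$ is a 2-absorbing primary ideal of $R$ and for each $x,y\in K$ with $xy\notin I$ we have $x^{-1}I\cap E(I)=\emptyset$ or $y^{-1}I\cap E(I)=\emptyset$. (b) $I$ is a strongly 2-absorbing primary ideal of $R$. Then (a) implies (b). Moreover, if $K\setminus E(I)$ is closed under addition (in particular, if $R$ is a rooty domain), then (b) implies (a).
   Context: Let $R$ be an integral domain with quotient field $K$. For a subset $S$ of $R$, $E(S)=\{x\in K: x^n\notin S \text{ for each } n\geq 1\}$. For $0\neq x\in K$, $x^{-1}I=\{x^{-1}a : a\in I\}\subseteq K$. A proper ideal $I$ of $R$ is 2-absorbing primary if whenever $a,b,c\in R$ and $abc\in I$, then $ab\in I$ or $ac\in\sqrt{I}$ or $bc\in\sqrt{I}$. A proper ideal $I$ of $R$ is a strongly 2-absorbing primary ideal if, whenever $xyz\in I$ for elements $x,y,z\in K$, we have either $xy\in I$ or $(yz)^n\in I$ or $(xz)^m\in I$ for some positive integers $n,m$. An ideal $J$ of $R$ is strongly radical if whenever $x\in K$ satisfies $x^n\in J$ for some $n\geq 1$, then $x\in J$. The domain $R$ is rooty if each radical ideal of $R$ is strongly radical (equivalently, each prime ideal of $R$ is strongly radical). *)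

theory Defs
  imports "HOL-Algebra.Algebra"
begin

text \<open>An integral domain together with its quotient field is modelled as a field \<open>K\<close> and a
  subdomain \<open>R\<close> of \<open>K\<close> all of whose fractions exhaust \<open>K\<close>; the domain itself is the ring
  \<open>K\<lparr>carrier := R\<rparr>\<close>.\<close>

locale quotient_field = field K + subdomain R K for K (structure) and R +
  assumes fraction: "x \<in> carrier K \<Longrightarrow> \<exists>a\<in>R. \<exists>b\<in>R - {\<zero>}. x = a \<otimes> inv b"

definition ideal_radical :: "('a, 'b) ring_scheme \<Rightarrow> 'a set \<Rightarrow> 'a set" where
  "ideal_radical A I = {a \<in> carrier A. \<exists>n::nat. n \<ge> 1 \<and> a [^]\<^bsub>A\<^esub> n \<in> I}"

definition two_absorbing_primary :: "'a set \<Rightarrow> ('a, 'b) ring_scheme \<Rightarrow> bool" where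
  "two_absorbing_primary I A \<longleftrightarrow>
     ideal I A \<and> I \<noteq> carrier A \<and>
     (\<forall>a\<in>carrier A. \<forall>b\<in>carrier A. \<forall>c\<in>carrier A.
        a \<otimes>\<^bsub>A\<^esub> b \<otimes>\<^bsub>A\<^esub> c \<in> I \<longrightarrow>
          a \<otimes>\<^bsub>A\<^esub> b \<in> I \<or> a \<otimes>\<^bsub>A\<^esub> c \<in> ideal_radical A I \<or> b \<otimes>\<^bsub>A\<^esub> c \<in> ideal_radical A I)"

definition no_power_in :: "('a, 'b) ring_scheme \<Rightarrow> 'a set \<Rightarrow> 'a set" where
  "no_power_in K S = {x \<in> carrier K. \<forall>n::nat. n \<ge> 1 \<longrightarrow> x [^]\<^bsub>K\<^esub> n \<notin> S}"

definition strongly_two_absorbing_primary ::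
    "('a, 'b) ring_scheme \<Rightarrow> 'a set \<Rightarrow> 'a set \<Rightarrow> bool" where
  "strongly_two_absorbing_primary K R I \<longleftrightarrow>
     ideal I (K\<lparr>carrier := R\<rparr>) \<and> I \<noteq> R \<and>
     (\<forall>x\<in>carrier K. \<forall>y\<in>carrier K. \<forall>z\<in>carrier K.
        x \<otimes>\<^bsub>K\<^esub> y \<otimes>\<^bsub>K\<^esub> z \<in> I \<longrightarrow>
          x \<otimes>\<^bsub>K\<^esub> y \<in> I \<or>
          (\<exists>n::nat. n \<ge> 1 \<and> (y \<otimes>\<^bsub>K\<^esub> z) [^]\<^bsub>K\<^esub> n \<in> I) \<or>
          (\<exists>m::nat. m \<ge> 1 \<and> (x \<otimes>\<^bsub>K\<^esub> z) [^]\<^bsub>K\<^esub> m \<in> I))"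

definition strongly_radical :: "('a, 'b) ring_scheme \<Rightarrow> 'a set \<Rightarrow> bool" where
  "strongly_radical K J \<longleftrightarrow>
     (\<forall>x\<in>carrier K. \<forall>n::nat. n \<ge> 1 \<longrightarrow> x [^]\<^bsub>K\<^esub> n \<in> J \<longrightarrow> x \<in> J)"

text \<open>Radical ideals are proper here. With the unit ideal included, rootiness would also force
  \<open>R\<close> to be root closed in \<open>K\<close>, and would no longer be equivalent to all prime ideals being
  strongly radical (consider \<open>R = \<rat> + T\<rat>(\<surd>2)[[T]]\<close>).\<close>

definition rooty :: "('a, 'b) ring_scheme \<Rightarrow> 'a set \<Rightarrow> bool" where
  "rooty K R \<longleftrightarrow>
     (\<forall>J. ideal J (K\<lparr>carrier := R\<rparr>) \<and> J \<noteq> R \<and> ideal_radical (K\<lparr>carrier := R\<rparr>) J = J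
        \<longrightarrow> strongly_radical K J)"

end

theory Submission
  imports Defs
begin

text \<open>Write \<open>P\<close> for the set of all elements of \<open>K\<close> with a power in \<open>I\<close>, the complement of
  \<open>E(I)\<close>. If \<open>x y z \<in> I\<close> then \<open>y z \<in> x\<^sup>-\<^sup>1I\<close> and \<open>x z \<in> y\<^sup>-\<^sup>1I\<close>, which gives (b) from (a). Conversely,
  suppose that \<open>x y \<notin> I\<close> and that \<open>p, q \<in> I\<close> satisfy \<open>x\<^sup>-\<^sup>1p \<notin> P\<close> and \<open>y\<^sup>-\<^sup>1q \<notin> P\<close>. Applying (b) to
  \<open>x\<close>, \<open>y\<close> and \<open>x\<^sup>-\<^sup>1y\<^sup>-\<^sup>1r\<close> for \<open>r \<in> I\<close> yields \<open>x\<^sup>-\<^sup>1r \<in> P\<close> or \<open>y\<^sup>-\<^sup>1r \<in> P\<close>. Taking \<open>r = p\<close>, \<open>q\<close>, \<open>p + q\<close>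
  contradicts the closure of \<open>P\<close> under addition and negation, just as no group is the union of two
  proper subgroups. If \<open>R\<close> is rooty and \<open>I\<close> is proper, then \<open>P\<close> is the radical of \<open>I\<close> in \<open>R\<close>.\<close>

section \<open>Unit cancellation, and radicals of ideals in a commutative ring\<close>

lemma (in monoid) Units_mult_inv_cancel:
  assumes "x \<in> Units G" "y \<in> carrier G"
  shows "x \<otimes> (inv x \<otimes> y) = y"
  using assms m_assoc[of x "inv x" y] by (simp add: Units_closed)

lemma (in monoid) Units_inv_mult_cancel:
  assumes "x \<in> Units G" "y \<in> carrier G"
  shows "inv x \<otimes> (x \<otimes> y) = y"
  using assms m_assoc[of "inv x" x y] by (simp add: Units_closed)

text \<open>Stands in for the binomial expansion of \<open>u \<oplus> v\<close>. Splitting off one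
  factor of the sum raises either \<open>i\<close> or \<open>j\<close> by one, so
  \<open>i + j + k\<close> is preserved; once \<open>k\<close> is 0, the bound forces
  \<open>m \<le> i\<close> or \<open>n \<le> j\<close>, and \<open>I\<close> absorbs the rest. The
  case \<open>i = j = 0\<close>, \<open>k = m + n\<close> makes radicals closed under
  addition.\<close>

lemma (in cring) pow_mult_pow_mult_add_pow_mem_ideal:
  assumes "ideal I R" and u: "u \<in> carrier R" and v: "v \<in> carrier R"
    and um: "u [^] m \<in> I" and vn: "v [^] n \<in> I" and le: "m + n \<le> i + j + k"
  shows "u [^] i \<otimes> v [^] j \<otimes> (u \<oplus> v) [^] (k::nat) \<in> I"
  using le
proof (induction k arbitrary: i j)
  case 0
  interpret ideal I R by fact
  from 0 consider "m \<le> i" | "n \<le> j" by linarith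
  then show ?case
  proof cases
    case 1
    then have "u [^] i = u [^] m \<otimes> u [^] (i - m)"
      using u by (simp add: nat_pow_mult)
    then show ?thesis
      using um u v by (simp add: I_r_closed)
  next
    case 2
    then have "v [^] j = v [^] n \<otimes> v [^] (j - n)"
      using v by (simp add: nat_pow_mult)
    then show ?thesis
      using vn u v by (simp add: I_l_closed I_r_closed)
  qed
next
  case (Suc k)
  interpret ideal I R by fact
  have "u [^] Suc i \<otimes> v [^] j \<otimes> (u \<oplus> v) [^] k \<in> I" "u [^] i \<otimes> v [^] Suc j \<otimes> (u \<oplus> v) [^] k \<in> I"
    using Suc.prems Suc.IH[of "Suc i" j] Suc.IH[of i "Suc j"] by simp_all
  moreover have "u [^] i \<otimes> v [^] j \<otimes> (u \<oplus> v) [^] Suc k =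
      (u [^] Suc i \<otimes> v [^] j \<otimes> (u \<oplus> v) [^] k) \<oplus> (u [^] i \<otimes> v [^] Suc j \<otimes> (u \<oplus> v) [^] k)"
    using u v by (simp add: r_distr l_distr m_ac)
  ultimately show ?case
    by simp
qed

lemma (in cring) ideal_radical_add_closed:
  assumes "ideal I R" "u \<in> ideal_radical R I" "v \<in> ideal_radical R I"
  shows "u \<oplus> v \<in> ideal_radical R I"
proof -
  from assms obtain m n :: nat where u: "u \<in> carrier R" and v: "v \<in> carrier R"
    and "m \<ge> 1" "u [^] m \<in> I" "v [^] n \<in> I"
    unfolding ideal_radical_def by blast
  then have "u [^] (0::nat) \<otimes> v [^] (0::nat) \<otimes> (u \<oplus> v) [^] (m + n) \<in> I"
    using assms(1) by (intro pow_mult_pow_mult_add_pow_mem_ideal) auto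
  then have "(u \<oplus> v) [^] (m + n) \<in> I"
    using u v by simp
  then show ?thesis
    using u v \<open>m \<ge> 1\<close> unfolding ideal_radical_def by (auto intro!: exI[of _ "m + n"])
qed

lemma (in cring) ideal_radical_mult_closed:
  assumes "ideal I R" "u \<in> ideal_radical R I" "r \<in> carrier R"
  shows "r \<otimes> u \<in> ideal_radical R I"
proof -
  interpret ideal I R by fact
  from assms obtain n :: nat where u: "u \<in> carrier R" and n: "n \<ge> 1" "u [^] n \<in> I"
    unfolding ideal_radical_def by blast
  have "(r \<otimes> u) [^] n \<in> I"
    using n u assms(3) by (simp add: nat_pow_distrib I_l_closed)
  then show ?thesis
    using u n assms(3) unfolding ideal_radical_def by auto
qed

lemma (in cring) ideal_ideal_radical:
  assumes "ideal I R"
  shows "ideal (ideal_radical R I) R"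
proof -
  interpret ideal I R by fact
  have sub: "ideal_radical R I \<subseteq> carrier R"
    unfolding ideal_radical_def by blast
  have zero: "\<zero> \<in> ideal_radical R I"
    unfolding ideal_radical_def by (auto intro!: exI[of _ "1::nat"])
  have neg: "\<ominus> u \<in> ideal_radical R I" if "u \<in> ideal_radical R I" for u
    using ideal_radical_mult_closed[OF assms that, of "\<ominus> \<one>"] that sub by (auto simp: l_minus)
  have "subgroup (ideal_radical R I) (add_monoid R)"
    using sub zero neg ideal_radical_add_closed[OF assms]
    by (intro subgroup.intro) (auto simp: a_inv_def)
  then show ?thesis
    using ideal_radical_mult_closed[OF assms] sub
    by (intro idealI) (auto simp: m_comm ring_axioms subsetD)
qed

lemma (in cring) ideal_radical_idem:
  assumes "ideal I R"
  shows "ideal_radical R (ideal_radical R I) = ideal_radical R I"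
proof -
  have "x \<in> ideal_radical R I"
    if "x \<in> carrier R" "n \<ge> 1" "x [^] n \<in> ideal_radical R I" for x and n :: nat
  proof -
    from that obtain m :: nat where "m \<ge> 1" "(x [^] n) [^] m \<in> I"
      unfolding ideal_radical_def by blast
    then show ?thesis
      using that unfolding ideal_radical_def by (auto simp: nat_pow_pow intro!: exI[of _ "n * m"])
  qed
  moreover have "x \<in> ideal_radical R (ideal_radical R I)" if "x \<in> ideal_radical R I" for x
    proof -
    have "x \<in> carrier R" "x [^] (1::nat) \<in> ideal_radical R I"
      using that by (auto simp: ideal_radical_def)
    then show ?thesis
      unfolding ideal_radical_def[of R "ideal_radical R I"] by blast
  qed
  ultimately show ?thesis
    unfolding ideal_radical_def[of R "ideal_radical R I"] by blast
qed

lemma (in cring) ideal_radical_proper: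
  assumes "ideal I R" "I \<noteq> carrier R"
  shows "ideal_radical R I \<noteq> carrier R"
proof
  assume "ideal_radical R I = carrier R"
  then have "\<one> \<in> ideal_radical R I"
    by simp
  then have "\<one> \<in> I"
    unfolding ideal_radical_def by auto
  then show False
    using assms ideal.one_imp_carrier by blast
qed

section \<open>Elements of the quotient field with a power in the ideal\<close>

locale quotient_field_ideal = quotient_field +
  fixes I
  assumes ideal: "ideal I (K\<lparr>carrier := R\<rparr>)"
begin

definition P where
  "P = carrier K - no_power_in K I"

lemma mem_P_iff: "x \<in> P \<longleftrightarrow> x \<in> carrier K \<and> (\<exists>n::nat. n \<ge> 1 \<and> x [^] n \<in> I)"
  unfolding P_def no_power_in_def by blast

lemma I_subset: "I \<subseteq> R"
  using ideal.Icarr[OF ideal] by auto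

lemma I_carrier: "x \<in> I \<Longrightarrow> x \<in> carrier K"
  using I_subset subset by blast

lemma I_add_closed: "x \<in> I \<Longrightarrow> y \<in> I \<Longrightarrow> x \<oplus> y \<in> I"
  using additive_subgroup.a_closed[OF ideal.axioms(1)[OF ideal]] by simp

lemma zero_mem_I: "\<zero> \<in> I"
  using additive_subgroup.zero_closed[OF ideal.axioms(1)[OF ideal]] by simp

lemma R_mult_I_closed: "r \<in> R \<Longrightarrow> x \<in> I \<Longrightarrow> r \<otimes> x \<in> I"
  using ideal.I_l_closed[OF ideal, of x r] by simp

lemma cring_R: "cring (K\<lparr>carrier := R\<rparr>)"
  using subdomain_is_domain[OF subdomain_axioms] domain.axioms(1) by blast

text \<open>Powers taken in the subring agree with powers in \<open>K\<close>, so the radical only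
  misses the elements of \<open>P\<close> outside \<open>R\<close>.\<close>

lemma ideal_radical_eq: "ideal_radical (K\<lparr>carrier := R\<rparr>) I = P \<inter> R"
  unfolding ideal_radical_def set_eq_iff Int_iff mem_P_iff mem_Collect_eq
    nat_pow_consistent[symmetric] using subset by auto

text \<open>As \<open>(\<ominus> x) [^] n\<close> is \<open>x [^] n\<close> times a power of
  \<open>\<ominus> \<one>\<close>, which lies in \<open>R\<close>, the ideal absorbs the sign
  without a case split on parity.\<close>

lemma P_minus_closed:
  assumes "x \<in> P"
  shows "\<ominus> x \<in> P"
proof -
  from assms obtain n :: nat where x: "x \<in> carrier K" and n: "n \<ge> 1" "x [^] n \<in> I"
    unfolding mem_P_iff by blast
  have "(\<ominus> \<one>) [^] n \<in> R"
    using subringE(3,5,6)[OF subring_axioms] by (induction n) auto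
  then have "(\<ominus> \<one> \<otimes> x) [^] n \<in> I"
    using n x by (simp add: nat_pow_distrib R_mult_I_closed)
  moreover have "\<ominus> \<one> \<otimes> x = \<ominus> x"
    using x by (simp add: l_minus)
  ultimately show ?thesis
    using x n unfolding mem_P_iff by auto
qed

text \<open>For nonzero \<open>x\<close> the inverse is genuine, so every
  \<open>inv x \<otimes> r\<close> lies in \<open>carrier K\<close>, where \<open>P\<close> and
  \<open>no_power_in K I\<close> are complementary. In the applications \<open>x\<close> is nonzero
  because \<open>x \<otimes> y \<notin> I\<close> while \<open>\<zero> \<in> I\<close>.\<close>

lemma l_coset_disjoint_iff:
  assumes "x \<in> carrier K - {\<zero>}"
  shows "(inv x <# I) \<inter> no_power_in K I = {} \<longleftrightarrow> (\<forall>r\<in>I. inv x \<otimes> r \<in> P)"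
  using assms I_carrier unfolding l_coset_def P_def by (fastforce simp: field_Units)

lemma strongly_two_absorbing_primary_iff:
  "strongly_two_absorbing_primary K R I \<longleftrightarrow> I \<noteq> R \<and>
     (\<forall>x\<in>carrier K. \<forall>y\<in>carrier K. \<forall>z\<in>carrier K.
        x \<otimes> y \<otimes> z \<in> I \<longrightarrow> x \<otimes> y \<in> I \<or> y \<otimes> z \<in> P \<or> x \<otimes> z \<in> P)"
  unfolding strongly_two_absorbing_primary_def mem_P_iff using ideal by simp

text \<open>Products of elements of \<open>R\<close> stay in \<open>R\<close>, so \<open>P\<close>
  can replace the radical. The condition is then the strong one with \<open>x\<close>,
  \<open>y\<close>, \<open>z\<close> restricted to \<open>R\<close>, which makes one half of (a) an
  immediate consequence of (b).\<close>

lemma two_absorbing_primary_iff: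
  "two_absorbing_primary I (K\<lparr>carrier := R\<rparr>) \<longleftrightarrow> I \<noteq> R \<and>
     (\<forall>x\<in>R. \<forall>y\<in>R. \<forall>z\<in>R.
        x \<otimes> y \<otimes> z \<in> I \<longrightarrow> x \<otimes> y \<in> I \<or> y \<otimes> z \<in> P \<or> x \<otimes> z \<in> P)"
  unfolding two_absorbing_primary_def ideal_radical_eq using ideal by auto

section \<open>The implications between (a) and (b), and rooty domains\<close>

lemma strongly_two_absorbing_primaryI:
  assumes "I \<noteq> R"
    and disj: "\<And>x y. \<lbrakk>x \<in> carrier K; y \<in> carrier K; x \<otimes> y \<notin> I\<rbrakk> \<Longrightarrow>
      (inv x <# I) \<inter> no_power_in K I = {} \<or> (inv y <# I) \<inter> no_power_in K I = {}"
  shows "strongly_two_absorbing_primary K R I"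
  unfolding strongly_two_absorbing_primary_iff
proof (intro conjI ballI impI)
  fix x y z
  assume x: "x \<in> carrier K" and y: "y \<in> carrier K" and z: "z \<in> carrier K" and I: "x \<otimes> y \<otimes> z \<in> I"
  show "x \<otimes> y \<in> I \<or> y \<otimes> z \<in> P \<or> x \<otimes> z \<in> P"
  proof (cases "x \<otimes> y \<in> I")
    case False
    then have nz: "x \<in> carrier K - {\<zero>}" "y \<in> carrier K - {\<zero>}"
      using x y zero_mem_I by auto
    then have U: "x \<in> Units K" "y \<in> Units K"
      by (auto simp: field_Units)
    have "inv x \<otimes> (x \<otimes> y \<otimes> z) = y \<otimes> z"
      using U x y z by (simp add: m_assoc Units_inv_mult_cancel)
    moreover have "inv y \<otimes> (y \<otimes> x \<otimes> z) = x \<otimes> z"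
      using U x y z by (simp add: m_assoc Units_inv_mult_cancel)
    ultimately show ?thesis
      using disj[OF x y False] I nz by (metis l_coset_disjoint_iff m_comm x y)
  qed simp
qed fact

lemma strongly_two_absorbing_primary_disjoint:
  assumes b: "strongly_two_absorbing_primary K R I"
    and add: "\<And>u v. \<lbrakk>u \<in> P; v \<in> P\<rbrakk> \<Longrightarrow> u \<oplus> v \<in> P"
    and x: "x \<in> carrier K" and y: "y \<in> carrier K" and xy: "x \<otimes> y \<notin> I"
  shows "(inv x <# I) \<inter> no_power_in K I = {} \<or> (inv y <# I) \<inter> no_power_in K I = {}"
proof (rule ccontr)
  have nz: "x \<in> carrier K - {\<zero>}" "y \<in> carrier K - {\<zero>}"
    using x y xy zero_mem_I by auto
  then have U: "x \<in> Units K" "y \<in> Units K"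
    by (auto simp: field_Units)
  assume "\<not> ?thesis"
  then obtain p q where p: "p \<in> I" "inv x \<otimes> p \<notin> P" and q: "q \<in> I" "inv y \<otimes> q \<notin> P"
    using nz by (auto simp: l_coset_disjoint_iff)
  have *: "inv x \<otimes> r \<in> P \<or> inv y \<otimes> r \<in> P" if r: "r \<in> I" for r
  proof -
    define z where "z = inv x \<otimes> (inv y \<otimes> r)"
    have rK: "r \<in> carrier K"
      using r I_carrier by blast
    have zK: "z \<in> carrier K"
      using U rK by (simp add: z_def)
    have yz: "y \<otimes> z = inv x \<otimes> r"
      using U x y rK by (simp add: z_def Units_mult_inv_cancel m_lcomm[of y "inv x"])
    have xz: "x \<otimes> z = inv y \<otimes> r"
      using U x y rK by (simp add: z_def Units_mult_inv_cancel)
    have "x \<otimes> y \<otimes> z = r"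
      using U x y zK rK by (simp add: m_assoc yz Units_mult_inv_cancel)
    then show ?thesis
      using b x y zK xy r unfolding strongly_two_absorbing_primary_iff
      by (metis xz yz)
  qed
  \<comment> \<open>Recovers the term of \<open>r\<close> as a difference: \<open>w\<close> will be
    \<open>x\<close> with \<open>r = p\<close>, or \<open>y\<close> with \<open>r = q\<close>, and
    the conclusion then contradicts the choice of \<open>p\<close> or \<open>q\<close>.\<close>
  have diff: "inv w \<otimes> r \<in> P"
    if "inv w \<otimes> (r \<oplus> s) \<in> P" "inv w \<otimes> s \<in> P" "w \<in> Units K" "r \<in> I" "s \<in> I" for w r s
  proof -
    have "inv w \<otimes> (r \<oplus> s) \<oplus> \<ominus> (inv w \<otimes> s) = inv w \<otimes> r"
      using that I_carrier by (simp add: r_distr a_assoc r_neg)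
    then show ?thesis
      using add[OF that(1) P_minus_closed[OF that(2)]] by simp
  qed
  \<comment> \<open>Each of \<open>p\<close> and \<open>q\<close> fails for one of the two inverses,
    so by \<open>*\<close> it succeeds for the other.\<close>
  have "inv y \<otimes> p \<in> P" "inv x \<otimes> q \<in> P"
    using * p q by blast+
  moreover have "p \<oplus> q = q \<oplus> p"
    using p q I_carrier a_comm by blast
  ultimately show False
    using *[OF I_add_closed[OF p(1) q(1)]] diff[of x p q] diff[of y q p] p q U by auto
qed

text \<open>The radical of a proper ideal is a proper radical ideal, hence strongly radical in a
  rooty domain. Since it contains \<open>I\<close>, any element of \<open>K\<close> with a power in
  \<open>I\<close> already lies in it. Properness matters because \<open>rooty\<close> speaks only
  of proper ideals.\<close>

lemma rooty_P_eq:
  assumes "rooty K R" "I \<noteq> R"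
  shows "P = ideal_radical (K\<lparr>carrier := R\<rparr>) I"
proof -
  interpret S: cring "K\<lparr>carrier := R\<rparr>" by (rule cring_R)
  let ?J = "ideal_radical (K\<lparr>carrier := R\<rparr>) I"
  have "strongly_radical K ?J"
    using assms S.ideal_ideal_radical[OF ideal] S.ideal_radical_idem[OF ideal]
      S.ideal_radical_proper[OF ideal]
    unfolding rooty_def by simp
  moreover have "I \<subseteq> ?J"
    using I_subset by (force simp: ideal_radical_def intro!: exI[of _ "1::nat"])
  ultimately have "P \<subseteq> ?J"
    unfolding strongly_radical_def mem_P_iff subset_iff by blast
  then show ?thesis
    using ideal_radical_eq by blast
qed

lemma rooty_P_add_closed:
  assumes "rooty K R" "I \<noteq> R" "u \<in> P" "v \<in> P"
  shows "u \<oplus> v \<in> P"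
  using cring.ideal_radical_add_closed[OF cring_R ideal, of u v] assms by (simp add: rooty_P_eq)

end

theorem theorem2p5:
  fixes K :: "('a, 'b) ring_scheme" (structure) and R I :: "'a set"
  assumes "quotient_field K R"
    and "ideal I (K\<lparr>carrier := R\<rparr>)"
  defines "a \<equiv> two_absorbing_primary I (K\<lparr>carrier := R\<rparr>) \<and>
      (\<forall>x\<in>carrier K. \<forall>y\<in>carrier K. x \<otimes> y \<notin> I \<longrightarrow>
         (inv x <# I) \<inter> no_power_in K I = {} \<or> (inv y <# I) \<inter> no_power_in K I = {})"
    and "b \<equiv> strongly_two_absorbing_primary K R I"
    and "sum_closed \<equiv> \<forall>u\<in>carrier K - no_power_in K I. \<forall>v\<in>carrier K - no_power_in K I.
      u \<oplus> v \<in> carrier K - no_power_in K I"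
  shows "(a \<longrightarrow> b) \<and>
         (sum_closed \<longrightarrow> b \<longrightarrow> a) \<and>
         (rooty K R \<longrightarrow> I \<noteq> R \<longrightarrow> sum_closed) \<and>
         (rooty K R \<longrightarrow> b \<longrightarrow> a)"
proof -
  interpret quotient_field_ideal K R I
    using assms(1,2) by (simp add: quotient_field_ideal_def quotient_field_ideal_axioms_def)
  have sum_closed: "sum_closed \<longleftrightarrow> (\<forall>u\<in>P. \<forall>v\<in>P. u \<oplus> v \<in> P)"
    unfolding sum_closed_def P_def by simp
  have "b" if "a"
    using that unfolding a_def b_def
    by (intro strongly_two_absorbing_primaryI) (auto simp: two_absorbing_primary_iff)
  moreover have "a" if "sum_closed" "b"
  proof -
    have "two_absorbing_primary I (K\<lparr>carrier := R\<rparr>)"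
      using \<open>b\<close> subset unfolding b_def two_absorbing_primary_iff strongly_two_absorbing_primary_iff
      by blast
    then show ?thesis
      using that strongly_two_absorbing_primary_disjoint unfolding a_def b_def sum_closed by blast
  qed
  moreover have "sum_closed" if "rooty K R" "I \<noteq> R"
    using that rooty_P_add_closed unfolding sum_closed by blast
  \<comment> \<open>Supplies the properness that the rooty case requires, so that rootiness and (b)
    together give closure under sums and then (a).\<close>
  moreover have "I \<noteq> R" if "b"
    using that unfolding b_def strongly_two_absorbing_primary_def by blast
  ultimately show ?thesis
    by blast
qed

end
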